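(* The optimal universal bounds for the number of distances $g_N$ in dimensions $1$, $2$, and $3$ are, respectively, $3$, $5$, and $9$. That is, for $d=1,2,3$, the smallest integer $B_d$ such that $g_N(\boldsymbol\alpha,\mathcal L)\le B_d$ for every $d$-dimensional real inner-product space $V$, every full-rank lattice $\mathcal L\subset V$, every $\boldsymbol\alpha\in V$, and every integer $N\ge 2$ is $$ B_1=3,\qquad B_2=5,\qquad B_3=9. $$
   Context: Let $V$ be a $d$-dimensional real inner-product space with induced norm $\|\cdot\|$, $\mathcal L\subset V$ a full-rank lattice (a discrete subgroup spanning $V$), and $\boldsymbol\alpha\in V$. For integers $N\ge 2$ and $1\le n\le N$, set $$\delta_{n,N}=\min\{\|(m-n)\boldsymbol\alpha+\ell\| : m\in\mathbb Z,\ 1\le m\le N,\ \ell\in\mathcal L,\ (m-n)\boldsymbol\alpha+\ell\neq 0\}.$$ (The choice $m=n$ is allowed, in which case $\ell$ is a nonzero lattice vector.) Define $g_N(\boldsymbol\alpha,\mathcal L)=\#\{\delta_{n,N}:1\le n\le N\}$, the number of distinct values among $\delta_{1,N},\dots,\delta_{N,N}$. *)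

theory Defs
  imports "HOL-Analysis.Analysis"
begin

text \<open>
  A full-rank lattice \<open>L\<close> in the inner-product space \<open>V\<close>, where \<open>V\<close> is a linear subspace of an
  ambient Euclidean space: a discrete additive subgroup whose real span is \<open>V\<close>.
\<close>
definition full_rank_lattice :: "'a::euclidean_space set \<Rightarrow> 'a set \<Rightarrow> bool" where
  "full_rank_lattice V L \<longleftrightarrow>
     0 \<in> L \<and> (\<forall>x\<in>L. \<forall>y\<in>L. x + y \<in> L) \<and> (\<forall>x\<in>L. - x \<in> L) \<and>
     discrete L \<and> span L = V"

text \<open>
  The minimum is attained for \<open>1 \<le> n \<le> N\<close> and a lattice \<open>L \<noteq> {0}\<close>, as \<open>L\<close> is discrete; then
  \<open>LEAST\<close> denotes it.
\<close>
definition delta :: "'a::euclidean_space \<Rightarrow> 'a set \<Rightarrow> int \<Rightarrow> int \<Rightarrow> real" where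
  "delta \<alpha> L N n =
     (LEAST r. r \<in> {norm (of_int (m - n) *\<^sub>R \<alpha> + l) | m l.
        1 \<le> m \<and> m \<le> N \<and> l \<in> L \<and> of_int (m - n) *\<^sub>R \<alpha> + l \<noteq> 0})"

definition num_distances :: "'a::euclidean_space \<Rightarrow> 'a set \<Rightarrow> int \<Rightarrow> nat" where
  "num_distances \<alpha> L N = card (delta \<alpha> L N ` {1..N})"

text \<open>
  Since HOL cannot quantify over types inside a formula, the \<open>d\<close>-dimensional inner-product spaces
  \<open>V\<close> are the \<open>d\<close>-dimensional subspaces of the ambient type. Every \<open>d\<close>-dimensional space occurs:
  take it as the ambient type itself, with \<open>V = UNIV\<close>.
\<close>
definition universal_distance_bound :: "'a::euclidean_space itself \<Rightarrow> nat \<Rightarrow> int \<Rightarrow> bool" where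
  "universal_distance_bound _ d B \<longleftrightarrow>
     (\<forall>(V :: 'a set) L \<alpha> N.
        subspace V \<and> dim V = d \<and> full_rank_lattice V L \<and> \<alpha> \<in> V \<and> N \<ge> 2 \<longrightarrow>
        int (num_distances \<alpha> L N) \<le> B)"

definition optimal_distance_bound :: "'a::euclidean_space itself \<Rightarrow> nat \<Rightarrow> int \<Rightarrow> bool" where
  "optimal_distance_bound T d B \<longleftrightarrow>
     universal_distance_bound T d B \<and> (\<forall>B'. universal_distance_bound T d B' \<longrightarrow> B \<le> B')"

end

(*
  Reversing the sign of a difference shows that delta_n is the minimal norm D(K) of a nonzero
  vector k alpha + l with |k| <= K = max (n - 1) (N - n). As K ranges between M = N div 2 and
  N - 1 <= 2 M, the number of distances is 1 plus the number of records i in (M, 2 M], where D drops.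

  Upper bound: let w_i = (i, l_i) in Z x L be the point attaining the record i. Modulo 2, no w_i and
  no sum of two or three distinct w_i vanishes. For one or two, half of the sum or difference would
  have a multiplier at most M and a norm below D(M). For three, write w_i = a+b, w_j = a+c,
  w_k = b+c with k < j < i and compare norms in
  |a|^2 + |b|^2 + |c|^2 + |a+b+c|^2 = |a+b|^2 + |a+c|^2 + |b+c|^2:
  b and c have multipliers at most M, hence norms at least D(M), and a has a multiplier below j.
  Hence the w_i and the w_i + w_{i0}, for a fixed record i0, are distinct in (Z x L) / 2, which
  has 2^(d+1) elements, so there are at most 2^d records.

  Lower bound for d <= 3: the 2^d vertices of a cube are the minimal vectors (up to sign) of the
  body centred cubic lattice; a slight perturbation orders their norms so that all are records.
*)
theory Submission
  imports Defs
begin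

section \<open>Discrete subgroups of a Euclidean space and their classes modulo 2\<close>

locale discrete_subgroup =
  fixes L :: "'a::euclidean_space set"
  assumes zero: "0 \<in> L"
    and add: "\<And>x y. x \<in> L \<Longrightarrow> y \<in> L \<Longrightarrow> x + y \<in> L"
    and neg: "\<And>x. x \<in> L \<Longrightarrow> - x \<in> L"
    and discrete: "discrete L"
begin

lemma diff: "x \<in> L \<Longrightarrow> y \<in> L \<Longrightarrow> x - y \<in> L"
  using add[of x "- y"] neg by simp

lemma scale_int: assumes "x \<in> L" shows "of_int k *\<^sub>R x \<in> L"
proof (cases k)
  case (nonneg n)
  have "real n *\<^sub>R x \<in> L" for n
    by (induction n) (auto simp: zero scaleR_add_left assms intro!: add)
  then show ?thesis using nonneg by simp
next
  case (neg n)
  have "real n *\<^sub>R x \<in> L" for n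
    by (induction n) (auto simp: zero scaleR_add_left assms intro!: add)
  from discrete_subgroup.neg[OF discrete_subgroup_axioms this[of "Suc n"]] show ?thesis
    using neg by (simp add: scaleR_minus_left[symmetric] del: scaleR_minus_left)
qed

lemma sum: "finite C \<Longrightarrow> (\<And>c. c \<in> C \<Longrightarrow> f c \<in> L) \<Longrightarrow> (\<Sum>c\<in>C. f c) \<in> L"
  by (induction C rule: finite_induct) (auto simp: zero add)

text \<open>Differences stay in \<open>L\<close>, so the radius isolating 0 separates all points of
  \<open>L\<close>, and a bounded uniformly discrete set is finite.\<close>

lemma finite_Int_cball: "finite (L \<inter> cball a r)"
proof -
  obtain e where e: "e > 0" "\<And>y. y \<in> L \<Longrightarrow> dist 0 y < e \<Longrightarrow> y = 0"
    using discreteD[OF discrete zero] unfolding isolated_in_dist_Ex_iff by auto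
  have "uniform_discrete L"
    unfolding uniform_discrete_def
  proof (intro exI[of _ e] conjI ballI impI)
    fix x y assume "x \<in> L" "y \<in> L" "dist x y < e"
    then show "x = y" using e(2)[of "x - y"] diff[of x y] by (simp add: dist_norm norm_minus_commute[of y x])
  qed (use e in auto)
  then have "uniform_discrete (L \<inter> cball a r)" by (rule uniform_discrete_subset) auto
  then show ?thesis
    using uniform_discrete_finite_iff[of "L \<inter> cball a r"] bounded_subset[OF bounded_cball] by blast
qed

text \<open>Rounding the coefficients down leaves coefficients in [0, 1), so translation by lattice
  points brings the whole span into one bounded region.\<close>

lemma span_approx:
  assumes "finite C" "C \<subseteq> L" "y \<in> span C"
  obtains l where "l \<in> L" "l \<in> span C" "norm (y - l) \<le> (\<Sum>c\<in>C. norm c)"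
proof -
  obtain u where u: "y = (\<Sum>c\<in>C. u c *\<^sub>R c)"
    using assms by (auto simp: span_finite)
  define l where "l = (\<Sum>c\<in>C. of_int \<lfloor>u c\<rfloor> *\<^sub>R c)"
  have "y - l = (\<Sum>c\<in>C. frac (u c) *\<^sub>R c)"
    by (simp add: u l_def frac_def sum_subtractf[symmetric] scaleR_diff_left)
  also have "norm \<dots> \<le> (\<Sum>c\<in>C. norm c)"
  proof (rule sum_norm_le)
    fix c assume "c \<in> C"
    have "\<bar>frac (u c)\<bar> \<le> 1" using frac_lt_1[of "u c"] frac_ge_0[of "u c"] by linarith
    then show "norm (frac (u c) *\<^sub>R c) \<le> norm c"
      by (simp add: mult_left_le_one_le)
  qed
  finally have "norm (y - l) \<le> (\<Sum>c\<in>C. norm c)" .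
  moreover have "l \<in> L" unfolding l_def
    using assms by (intro sum scale_int) auto
  moreover have "l \<in> span C" unfolding l_def
    by (intro span_sum span_mul span_base)
  ultimately show ?thesis by (intro that)
qed

text \<open>
  The coefficients of \<open>c\<close> on \<open>L\<close> form a discrete subgroup of the reals, since modulo
  \<open>L \<inter> span C\<close> the remaining coordinates can be kept bounded.
\<close>
lemma span_insert_generator:
  assumes "finite C" "independent (insert c C)" "c \<notin> C" "insert c C \<subseteq> L"
  obtains x0 where "x0 \<in> L"
    "\<And>x. x \<in> L \<Longrightarrow> x \<in> span (insert c C) \<Longrightarrow> \<exists>m::int. x - of_int m *\<^sub>R x0 \<in> span C"
proof -
  have cC: "c \<notin> span C" using assms by (simp add: independent_insert)
  have uniq: "s = t" if "x - s *\<^sub>R c \<in> span C" "x - t *\<^sub>R c \<in> span C" for s t x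
  proof (rule ccontr)
    assume "s \<noteq> t"
    have "(t - s) *\<^sub>R c \<in> span C"
      using span_diff[OF that] by (simp add: algebra_simps)
    then have "(1 / (t - s)) *\<^sub>R ((t - s) *\<^sub>R c) \<in> span C" by (rule span_mul)
    with \<open>s \<noteq> t\<close> cC show False by simp
  qed
  define T where "T = {t. \<exists>x\<in>L. x - t *\<^sub>R c \<in> span C}"
  define U where "U = {t\<in>T. 0 < t \<and> t \<le> 1}"
  define F where "F = L \<inter> cball 0 (norm c + (\<Sum>c\<in>C. norm c))"
  \<comment> \<open>Every \<open>t\<close> in \<open>U\<close> is the coefficient of some point of
    the finite set \<open>F\<close>, and by \<open>uniq\<close> the point determines it; hence
    \<open>U\<close> is finite.\<close>
  have "U \<subseteq> (\<lambda>x. SOME t. x - t *\<^sub>R c \<in> span C) ` F"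
  proof
    fix t assume t: "t \<in> U"
    then obtain x where x: "x \<in> L" "x - t *\<^sub>R c \<in> span C" by (auto simp: U_def T_def)
    obtain l where l: "l \<in> L" "l \<in> span C" "norm (x - t *\<^sub>R c - l) \<le> (\<Sum>c\<in>C. norm c)"
      using span_approx[of C "x - t *\<^sub>R c"] assms x by auto
    have "norm (t *\<^sub>R c) \<le> norm c" using t by (simp add: U_def mult_left_le_one_le)
    then have "norm (x - l) \<le> norm c + (\<Sum>c\<in>C. norm c)"
      using norm_triangle_ineq[of "t *\<^sub>R c" "x - t *\<^sub>R c - l"] l(3) by simp
    then have "x - l \<in> F" using x l by (auto simp: F_def diff)
    moreover have *: "(x - l) - t *\<^sub>R c \<in> span C"
      using span_diff[OF x(2) l(2)] by (simp add: algebra_simps)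
    moreover have "(SOME t. (x - l) - t *\<^sub>R c \<in> span C) = t"
      by (rule some_equality) (use * uniq in auto)
    ultimately show "t \<in> (\<lambda>x. SOME t. x - t *\<^sub>R c \<in> span C) ` F" by force
  qed
  then have finU: "finite U" using finite_Int_cball finite_surj unfolding F_def by blast
  \<comment> \<open>The vector \<open>c\<close> itself has coefficient 1. So \<open>U\<close> is
    nonempty and its minimum is at most 1, which puts any nonzero remainder \<open>r < t0\<close>
    back into \<open>U\<close>.\<close>
  have "1 \<in> U" using assms by (auto simp: U_def T_def span_zero intro!: bexI[of _ c])
  define t0 where "t0 = Min U"
  have t0: "t0 \<in> U" using finU \<open>1 \<in> U\<close> Min_in unfolding t0_def by auto
  then obtain x0 where x0: "x0 \<in> L" "x0 - t0 *\<^sub>R c \<in> span C" by (auto simp: U_def T_def)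
  have pos: "t0 > 0" "t0 \<le> 1" using t0 by (auto simp: U_def)
  show ?thesis
  proof (rule that[OF x0(1)])
    fix x assume x: "x \<in> L" "x \<in> span (insert c C)"
    then obtain t where t: "x - t *\<^sub>R c \<in> span C" by (auto simp: span_insert)
    define m where "m = \<lfloor>t / t0\<rfloor>"
    define r where "r = t - of_int m * t0"
    have *: "x - of_int m *\<^sub>R x0 - r *\<^sub>R c \<in> span C"
      using span_diff[OF t span_mul[OF x0(2), of "of_int m"]]
      by (simp add: r_def algebra_simps)
    have rb: "0 \<le> r" "r < t0"
    proof -
      have "of_int m \<le> t / t0" "t / t0 < of_int m + 1" unfolding m_def by linarith+
      then show "0 \<le> r" "r < t0" using pos by (auto simp: r_def field_simps)
    qed
    have "r \<in> T" unfolding T_def using * x x0 by (blast intro: diff scale_int)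
    have "r = 0"
    proof (rule ccontr)
      assume "r \<noteq> 0"
      then have "r \<in> U" using \<open>r \<in> T\<close> rb pos by (auto simp: U_def)
      then have "t0 \<le> r" using finU by (simp add: t0_def)
      then show False using rb by simp
    qed
    then show "\<exists>m::int. x - of_int m *\<^sub>R x0 \<in> span C" using * by auto
  qed
qed

text \<open>\<open>p\<close> encodes classes modulo \<open>2 L\<close> as subsets of
  \<open>C\<close>, which bounds their number by \<open>2 ^ card C\<close>. In the induction a
  multiple of the generator \<open>x0\<close> is split off, and membership of \<open>c\<close>
  records the parity of that multiple.\<close>

lemma parity_map:
  assumes "finite C" "independent C" "C \<subseteq> L"
  shows "\<exists>p::'a \<Rightarrow> 'a set. (\<forall>x\<in>L \<inter> span C. p x \<subseteq> C) \<and>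
    (\<forall>x\<in>L \<inter> span C. \<forall>y\<in>L \<inter> span C. p x = p y \<longrightarrow> (\<exists>z\<in>L. x - y = 2 *\<^sub>R z))"
  using assms
proof (induction C rule: finite_induct)
  case empty
  then show ?case by (auto simp: zero intro!: exI[of _ "\<lambda>_. {}"] bexI[of _ 0])
next
  case (insert c C)
  then obtain p where p: "\<And>x. x \<in> L \<inter> span C \<Longrightarrow> p x \<subseteq> C"
    "\<And>x y. x \<in> L \<inter> span C \<Longrightarrow> y \<in> L \<inter> span C \<Longrightarrow> p x = p y \<Longrightarrow> \<exists>z\<in>L. x - y = 2 *\<^sub>R z"
    by (metis independent_insert insert_subset)
  obtain x0 where x0: "x0 \<in> L"
    "\<And>x. x \<in> L \<Longrightarrow> x \<in> span (insert c C) \<Longrightarrow> \<exists>m::int. x - of_int m *\<^sub>R x0 \<in> span C"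
    using span_insert_generator[of C c] insert by metis
  define \<mu> :: "'a \<Rightarrow> int" where "\<mu> x = (SOME m. x - of_int m *\<^sub>R x0 \<in> span C)" for x
  define r where "r x = x - of_int (\<mu> x) *\<^sub>R x0" for x
  have r: "r x \<in> L \<inter> span C" if "x \<in> L \<inter> span (insert c C)" for x
    using that someI_ex[OF x0(2)[of x]] x0(1) by (auto simp: r_def \<mu>_def intro!: diff scale_int)
  define q where "q x = p (r x) \<union> (if odd (\<mu> x) then {c} else {})" for x
  show ?case
  proof (intro exI[of _ q] conjI ballI impI)
    fix x assume "x \<in> L \<inter> span (insert c C)"
    then show "q x \<subseteq> insert c C" using p(1)[OF r] by (auto simp: q_def)
  next
    fix x y assume x: "x \<in> L \<inter> span (insert c C)" and y: "y \<in> L \<inter> span (insert c C)"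
      and q: "q x = q y"
    have sub: "p (r x) \<subseteq> C" "p (r y) \<subseteq> C" using p(1) r x y by auto
    have "p (r x) = q x - {c}" "p (r y) = q y - {c}"
      using sub \<open>c \<notin> C\<close> by (auto simp: q_def)
    then have "p (r x) = p (r y)" using q by simp
    then obtain z where z: "z \<in> L" "r x - r y = 2 *\<^sub>R z" using p(2) r x y by blast
    have "odd (\<mu> x) \<longleftrightarrow> c \<in> q x" "odd (\<mu> y) \<longleftrightarrow> c \<in> q y"
      using sub \<open>c \<notin> C\<close> by (auto simp: q_def)
    then have "even (\<mu> x - \<mu> y)" using q by auto
    then obtain k where k: "\<mu> x - \<mu> y = 2 * k" by blast
    have "x - y = (r x - r y) + of_int (\<mu> x - \<mu> y) *\<^sub>R x0"
      by (simp add: r_def algebra_simps)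
    also have "\<dots> = 2 *\<^sub>R (z + of_int k *\<^sub>R x0)" by (simp add: z k scaleR_add_right)
    finally show "\<exists>z\<in>L. x - y = 2 *\<^sub>R z" using z(1) x0(1) add scale_int by blast
  qed
qed

text \<open>Pigeonhole in (Z x L) / 2: the parity of the multiplier and the subset given by
  \<open>parity_map\<close>, for a basis \<open>C\<close> chosen inside \<open>L\<close>, determine
  the class.\<close>

lemma card_incongruent_mod_2:
  fixes f :: "'i \<Rightarrow> int \<times> 'a"
  assumes fin: "finite I" and f: "\<And>i. i \<in> I \<Longrightarrow> snd (f i) \<in> L"
    and incongruent: "\<And>i j. i \<in> I \<Longrightarrow> j \<in> I \<Longrightarrow> i \<noteq> j \<Longrightarrow>
      even (fst (f i) - fst (f j)) \<Longrightarrow> (\<exists>z\<in>L. snd (f i) - snd (f j) = 2 *\<^sub>R z) \<Longrightarrow> False"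
  shows "card I \<le> 2 ^ (dim (span L) + 1)"
proof -
  obtain C where C: "C \<subseteq> L" "independent C" "L \<subseteq> span C" "card C = dim L"
    using basis_exists[of L] by metis
  have "finite C" using C finiteI_independent by blast
  obtain p where p: "\<And>x. x \<in> L \<Longrightarrow> p x \<subseteq> C"
    "\<And>x y. x \<in> L \<Longrightarrow> y \<in> L \<Longrightarrow> p x = p y \<Longrightarrow> \<exists>z\<in>L. x - y = 2 *\<^sub>R z"
    using parity_map[OF \<open>finite C\<close> C(2,1)] C(3) by (metis Int_absorb2)
  define P where "P i = (odd (fst (f i)), p (snd (f i)))" for i
  have "inj_on P I"
  proof (rule inj_onI, rule ccontr)
    fix i j assume ij: "i \<in> I" "j \<in> I" "P i = P j" "i \<noteq> j"
    then show False using incongruent[of i j] p(2)[of "snd (f i)" "snd (f j)"] f by (auto simp: P_def)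
  qed
  moreover have "P ` I \<subseteq> UNIV \<times> Pow C" using p(1) f by (auto simp: P_def)
  ultimately have "card I \<le> card ((UNIV :: bool set) \<times> Pow C)"
    using \<open>finite C\<close> by (intro card_inj_on_le) auto
  also have "\<dots> = 2 ^ (dim (span L) + 1)"
    using \<open>finite C\<close> C by (simp add: card_cartesian_product card_Pow dim_span)
  finally show ?thesis .
qed

end

section \<open>Distances as minimal norms over a symmetric range of multipliers\<close>

text \<open>This is D(K) of the overview. That \<open>LEAST\<close> denotes an attained minimum is
  the content of lemma \<open>min_distance\<close>.\<close>

definition min_distance :: "'a::euclidean_space \<Rightarrow> 'a set \<Rightarrow> int \<Rightarrow> real" where
  "min_distance \<alpha> L K =
     (LEAST r. r \<in> {norm (of_int k *\<^sub>R \<alpha> + l) | k l.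
        \<bar>k\<bar> \<le> K \<and> l \<in> L \<and> of_int k *\<^sub>R \<alpha> + l \<noteq> 0})"

context discrete_subgroup
begin

text \<open>The vector \<open>l0\<close>, with multiplier 0, is a candidate. Only finitely many
  candidates are no longer than it: there are finitely many \<open>k\<close>, and for each the
  lattice point lies in a ball about \<open>- k \<alpha>\<close>.\<close>

lemma min_distance:
  assumes "l0 \<in> L" "l0 \<noteq> 0" "K \<ge> 0"
  shows "min_distance \<alpha> L K \<in> {norm (of_int k *\<^sub>R \<alpha> + l) | k l.
        \<bar>k\<bar> \<le> K \<and> l \<in> L \<and> of_int k *\<^sub>R \<alpha> + l \<noteq> 0}" (is "_ \<in> ?R")
    and "\<And>k l. \<bar>k\<bar> \<le> K \<Longrightarrow> l \<in> L \<Longrightarrow> of_int k *\<^sub>R \<alpha> + l \<noteq> 0 \<Longrightarrow>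
           min_distance \<alpha> L K \<le> norm (of_int k *\<^sub>R \<alpha> + l)"
proof -
  have r0: "norm l0 \<in> ?R" using assms by (auto intro!: exI[of _ 0] exI[of _ l0])
  have "?R \<inter> {..norm l0} \<subseteq>
      norm ` (\<Union>k\<in>{-K..K}. (\<lambda>l. of_int k *\<^sub>R \<alpha> + l) ` (L \<inter> cball (- (of_int k *\<^sub>R \<alpha>)) (norm l0)))"
  proof
    fix r assume "r \<in> ?R \<inter> {..norm l0}"
    then obtain k l where kl: "r = norm (of_int k *\<^sub>R \<alpha> + l)" "\<bar>k\<bar> \<le> K" "l \<in> L" "r \<le> norm l0"
      by auto
    have "norm (- (of_int k *\<^sub>R \<alpha>) - l) = r"
      using norm_minus_cancel[of "of_int k *\<^sub>R \<alpha> + l"] by (simp add: kl(1))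
    then have "of_int k *\<^sub>R \<alpha> + l \<in> (\<Union>k\<in>{-K..K}. (\<lambda>l. of_int k *\<^sub>R \<alpha> + l) `
        (L \<inter> cball (- (of_int k *\<^sub>R \<alpha>)) (norm l0)))"
      using kl by (intro UN_I[of k] image_eqI[of _ _ l]) (auto simp: dist_norm)
    then show "r \<in> norm ` (\<Union>k\<in>{-K..K}. (\<lambda>l. of_int k *\<^sub>R \<alpha> + l) `
        (L \<inter> cball (- (of_int k *\<^sub>R \<alpha>)) (norm l0)))"
      unfolding kl(1) by (rule imageI)
  qed
  then have fin: "finite (?R \<inter> {..norm l0})"
    by (rule finite_subset) (intro finite_imageI finite_UN_I finite_Int_cball finite_atLeastAtMost_int)
  define m where "m = Min (?R \<inter> {..norm l0})"
  have m: "m \<in> ?R \<inter> {..norm l0}" unfolding m_def using r0 by (intro Min_in fin) auto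
  have le: "m \<le> r" if "r \<in> ?R" for r
  proof (cases "r \<le> norm l0")
    case True
    then show ?thesis unfolding m_def using that fin by (intro Min_le) auto
  qed (use m in auto)
  have "min_distance \<alpha> L K = m"
    unfolding min_distance_def by (rule Least_equality) (use m le in blast)+
  then show "min_distance \<alpha> L K \<in> ?R"
    and "\<And>k l. \<bar>k\<bar> \<le> K \<Longrightarrow> l \<in> L \<Longrightarrow> of_int k *\<^sub>R \<alpha> + l \<noteq> 0 \<Longrightarrow>
           min_distance \<alpha> L K \<le> norm (of_int k *\<^sub>R \<alpha> + l)"
    using m le by blast+
qed

text \<open>Negating a vector negates its multiple of \<open>\<alpha>\<close>, so only the larger of the two ranges of
  \<open>m - n\<close> matters.\<close>
lemma delta_eq_min_distance:
  assumes "1 \<le> n" "n \<le> N"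
  shows "delta \<alpha> L N n = min_distance \<alpha> L (max (n - 1) (N - n))"
proof -
  have "{norm (of_int (m - n) *\<^sub>R \<alpha> + l) | m l.
          1 \<le> m \<and> m \<le> N \<and> l \<in> L \<and> of_int (m - n) *\<^sub>R \<alpha> + l \<noteq> 0} =
        {norm (of_int k *\<^sub>R \<alpha> + l) | k l.
          \<bar>k\<bar> \<le> max (n - 1) (N - n) \<and> l \<in> L \<and> of_int k *\<^sub>R \<alpha> + l \<noteq> 0}" (is "?A = ?B")
  proof (intro equalityI subsetI)
    fix r assume "r \<in> ?A"
    then obtain m l where "r = norm (of_int (m - n) *\<^sub>R \<alpha> + l)" "1 \<le> m" "m \<le> N" "l \<in> L"
      "of_int (m - n) *\<^sub>R \<alpha> + l \<noteq> 0" by blast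
    moreover from this have "\<bar>m - n\<bar> \<le> max (n - 1) (N - n)" by linarith
    ultimately show "r \<in> ?B" by blast
  next
    fix r assume "r \<in> ?B"
    then obtain k l where k: "r = norm (of_int k *\<^sub>R \<alpha> + l)" "\<bar>k\<bar> \<le> max (n - 1) (N - n)"
      "l \<in> L" "of_int k *\<^sub>R \<alpha> + l \<noteq> 0" by blast
    have k': "r = norm (of_int (- k) *\<^sub>R \<alpha> + (- l))" "- l \<in> L" "of_int (- k) *\<^sub>R \<alpha> + (- l) \<noteq> 0"
      using k neg norm_minus_cancel[of "of_int k *\<^sub>R \<alpha> + l"]
      by (auto simp: add_eq_0_iff)
    have "1 \<le> n + k \<and> n + k \<le> N \<or> 1 \<le> n + (- k) \<and> n + (- k) \<le> N" using k(2) assms by linarith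
    then show "r \<in> ?A"
    proof
      assume "1 \<le> n + k \<and> n + k \<le> N"
      then show ?thesis using k by (intro CollectI exI[of _ "n + k"] exI[of _ l]) auto
    next
      assume "1 \<le> n + (- k) \<and> n + (- k) \<le> N"
      then show ?thesis using k' by (intro CollectI exI[of _ "n + (- k)"] exI[of _ "- l"]) auto
    qed
  qed
  then show ?thesis unfolding delta_def min_distance_def by simp
qed

end

section \<open>Upper bound: counting records modulo 2\<close>

text \<open>A nonincreasing sequence takes a new value only where it drops.\<close>

lemma image_subset_records:
  fixes D :: "int \<Rightarrow> real"
  assumes "\<And>K. M < K \<Longrightarrow> D K \<le> D (K - 1)"
  shows "D ` {M..M'} \<subseteq> insert (D M) (D ` {K\<in>{M<..M'}. D K < D (K - 1)})"
proof -
  have "K \<le> M' \<longrightarrow> D K \<in> insert (D M) (D ` {K\<in>{M<..M'}. D K < D (K - 1)})" if "M \<le> K" for K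
    using that
  proof (induction K rule: int_ge_induct)
    case (step K)
    show ?case
    proof (cases "D (K + 1) = D K")
      case False
      then have "D (K + 1) < D (K + 1 - 1)" using assms[of "K + 1"] step(1) by simp
      then show ?thesis using step(1) by auto
    qed (use step in auto)
  qed auto
  then show ?thesis by (meson atLeastAtMost_iff image_subsetI)
qed

text \<open>The identity of the overview with \<open>x\<close> = a+b, \<open>y\<close> = a+c,
  \<open>z\<close> = b+c. Each mixed inner product occurs twice with each sign and cancels.\<close>

lemma norm_sq_half_sums:
  fixes x y z :: "'a::real_inner"
  shows "(norm ((1/2) *\<^sub>R (x + y - z)))\<^sup>2 + (norm ((1/2) *\<^sub>R (x + z - y)))\<^sup>2
       + (norm ((1/2) *\<^sub>R (y + z - x)))\<^sup>2 + (norm ((1/2) *\<^sub>R (x + y + z)))\<^sup>2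
       = (norm x)\<^sup>2 + (norm y)\<^sup>2 + (norm z)\<^sup>2"
  by (simp add: power_divide power2_norm_eq_inner inner_add_left inner_add_right inner_diff_left
      inner_diff_right inner_commute field_simps)

text \<open>The lattice part \<open>l i\<close> belongs to a vector attaining the record, with the
  sign normalised to multiplier \<open>i\<close>. As records lie in (M, 2M], half of a record or of
  a difference of two has multiplier at most \<open>M\<close> in absolute value.\<close>

locale distance_records = discrete_subgroup L for L :: "'a::euclidean_space set" +
  fixes \<alpha> :: 'a and D :: "int \<Rightarrow> real" and M :: int and J :: "int set" and l :: "int \<Rightarrow> 'a"
  assumes le: "\<And>k K x. \<bar>k\<bar> \<le> K \<Longrightarrow> x \<in> L \<Longrightarrow> of_int k *\<^sub>R \<alpha> + x \<noteq> 0 \<Longrightarrow>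
                 D K \<le> norm (of_int k *\<^sub>R \<alpha> + x)"
    and anti: "\<And>K K'. 0 \<le> K \<Longrightarrow> K \<le> K' \<Longrightarrow> D K' \<le> D K"
    and M: "0 \<le> M" and J: "J \<subseteq> {M<..2*M}"
    and drop: "\<And>i. i \<in> J \<Longrightarrow> D i < D (i - 1)"
    and l: "\<And>i. i \<in> J \<Longrightarrow> l i \<in> L"
    and nonzero: "\<And>i. i \<in> J \<Longrightarrow> of_int i *\<^sub>R \<alpha> + l i \<noteq> 0"
    and norm_record: "\<And>i. i \<in> J \<Longrightarrow> norm (of_int i *\<^sub>R \<alpha> + l i) = D i"
begin

definition v :: "int \<Rightarrow> 'a" where "v i = of_int i *\<^sub>R \<alpha> + l i"

lemma J_bounds: "i \<in> J \<Longrightarrow> M < i" "i \<in> J \<Longrightarrow> i \<le> 2 * M"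
  using J by auto

lemma v_nonzero: "i \<in> J \<Longrightarrow> v i \<noteq> 0" and norm_v: "i \<in> J \<Longrightarrow> norm (v i) = D i"
  using nonzero norm_record by (auto simp: v_def)

lemma norm_v_less: "i \<in> J \<Longrightarrow> norm (v i) < D M"
  using drop[of i] anti[of M "i - 1"] M J_bounds(1)[of i] by (simp add: norm_v)

lemma D_strict: "i \<in> J \<Longrightarrow> 0 \<le> k \<Longrightarrow> k < i \<Longrightarrow> D i < D k"
  using drop[of i] anti[of k "i - 1"] by linarith

text \<open>The pair \<open>(m, y)\<close> is twice \<open>(k, x)\<close> in Z x L, so the half is
  again a vector to which \<open>le\<close> applies.\<close>

lemma le_half:
  assumes "x \<in> L" "2 *\<^sub>R x = y" "2 * k = m" "\<bar>m\<bar> \<le> 2 * K" "of_int m *\<^sub>R \<alpha> + y \<noteq> 0"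
  shows "D K \<le> norm ((1/2) *\<^sub>R (of_int m *\<^sub>R \<alpha> + y))"
proof -
  have *: "(1/2) *\<^sub>R (of_int m *\<^sub>R \<alpha> + y) = of_int k *\<^sub>R \<alpha> + x"
    using assms(2,3) by (auto simp: scaleR_add_right)
  have "of_int k *\<^sub>R \<alpha> + x \<noteq> 0" using assms(5) unfolding *[symmetric] by simp
  moreover have "\<bar>k\<bar> \<le> K" using assms by linarith
  ultimately show ?thesis unfolding * using assms(1) by (intro le) auto
qed

text \<open>Odd means not divisible by 2 in Z x L. Otherwise half of \<open>v i\<close> would have
  norm at least \<open>D M\<close>, although \<open>v i\<close> itself is shorter than that.\<close>

lemma record_odd:
  assumes "i \<in> J" "even i" "z \<in> L" "l i = 2 *\<^sub>R z"
  shows False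
proof -
  obtain k where k: "i = 2 * k" using assms(2) by blast
  have "D M \<le> norm ((1/2) *\<^sub>R (of_int i *\<^sub>R \<alpha> + l i))"
    by (rule le_half[of z _ k]) (use assms k nonzero[OF assms(1)] J_bounds[of i] M in auto)
  then have "2 * D M \<le> norm (v i)" by (simp add: v_def)
  then show False using norm_v_less[OF assms(1)] norm_ge_zero[of "v i"] by linarith
qed

text \<open>Half the difference would be shorter than \<open>D M\<close> by the triangle inequality.
  It is nonzero because distinct records have distinct norms.\<close>

lemma records_incongruent:
  assumes "i \<in> J" "j \<in> J" "i \<noteq> j" "even (i - j)" "z \<in> L" "l i - l j = 2 *\<^sub>R z"
  shows False
proof -
  obtain k where k: "i - j = 2 * k" using assms(4) by blast
  have eq: "of_int (i - j) *\<^sub>R \<alpha> + (l i - l j) = v i - v j"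
    by (simp add: v_def algebra_simps)
  have "D i \<noteq> D j"
    using D_strict[of i j] D_strict[of j i] assms M J_bounds[of i] J_bounds[of j]
    by (cases "i < j") auto
  then have "v i - v j \<noteq> 0" using norm_v[OF assms(1)] norm_v[OF assms(2)] by auto
  then have "D M \<le> norm ((1/2) *\<^sub>R (v i - v j))"
    unfolding eq[symmetric]
    by (intro le_half[of z _ k]) (use assms k J_bounds[of i] J_bounds[of j] M in auto)
  then show False
    using norm_v_less[OF assms(1)] norm_v_less[OF assms(2)] norm_triangle_ineq4[of "v i" "v j"] by simp
qed

text \<open>With a, b, c the halves of the overview, |a| >= \<open>D (j - 1)\<close> >=
  |\<open>v j\<close>|, |b| >= \<open>D M\<close> > |\<open>v i\<close>| and |c| >=
  \<open>D M\<close> > |\<open>v k\<close>|, which contradicts the identity.\<close>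

lemma sum_three_records_odd_less:
  assumes J: "i \<in> J" "j \<in> J" "k \<in> J" and less: "k < j" "j < i"
    and even: "even (i + j + k)" and z: "z \<in> L" "l i + l j + l k = 2 *\<^sub>R z"
  shows False
proof -
  obtain m where m: "i + j + k = 2 * m" using even by blast
  note bounds = J_bounds[OF J(1)] J_bounds[OF J(2)] J_bounds[OF J(3)] less M
  have eq: "of_int (i + j - k) *\<^sub>R \<alpha> + (l i + l j - l k) = v i + v j - v k"
    "of_int (i + k - j) *\<^sub>R \<alpha> + (l i + l k - l j) = v i + v k - v j"
    "of_int (j + k - i) *\<^sub>R \<alpha> + (l j + l k - l i) = v j + v k - v i"
    by (simp_all add: v_def algebra_simps)
  have halves: "2 *\<^sub>R (z - l k) = l i + l j - l k" "2 *\<^sub>R (z - l j) = l i + l k - l j"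
    "2 *\<^sub>R (z - l i) = l j + l k - l i"
    by (simp_all add: scaleR_diff_right z(2)[symmetric]) (simp_all add: scaleR_2)
  \<comment> \<open>The multiplier is at most \<open>j - 1\<close> because
    \<open>i - k <= M - 1\<close>, while \<open>k < j\<close> and \<open>k > M\<close> give
    \<open>j - 2 >= M\<close>.\<close>
  have a: "D (j - 1) \<le> norm ((1/2) *\<^sub>R (v i + v j - v k))" if "v i + v j - v k \<noteq> 0"
    using that unfolding eq[symmetric]
    by (intro le_half[of "z - l k" _ "m - k"])
      (use bounds m z halves l J in \<open>auto intro: diff\<close>)
  have b: "D M \<le> norm ((1/2) *\<^sub>R (v i + v k - v j))" if "v i + v k - v j \<noteq> 0"
    using that unfolding eq[symmetric]
    by (intro le_half[of "z - l j" _ "m - j"])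
      (use bounds m z halves l J in \<open>auto intro: diff\<close>)
  have c: "D M \<le> norm ((1/2) *\<^sub>R (v j + v k - v i))" if "v j + v k - v i \<noteq> 0"
    using that unfolding eq[symmetric]
    by (intro le_half[of "z - l i" _ "m - i"])
      (use bounds m z halves l J in \<open>auto intro: diff\<close>)
  \<comment> \<open>If one half vanishes, then another equals a record vector, which is too short
    for the bound \<open>D M\<close>.\<close>
  have b': "D M \<le> norm x" if "v i + v k - v j = 2 *\<^sub>R x" "x \<noteq> 0" for x
    using b that by simp
  have c': "D M \<le> norm x" if "v j + v k - v i = 2 *\<^sub>R x" "x \<noteq> 0" for x
    using c that by simp
  have small: "norm (v i) < D M" "norm (v j) < D M" "norm (v k) < D M"
    using norm_v_less J by auto
  have nz: "v i \<noteq> 0" "v j \<noteq> 0" "v k \<noteq> 0" using v_nonzero J by auto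
  have "v i + v j - v k \<noteq> 0"
  proof
    assume "v i + v j - v k = 0"
    then have "v k = v i + v j" by (simp add: algebra_simps)
    then show False using b'[of "v i"] small nz by (simp add: scaleR_2)
  qed
  moreover have "v i + v k - v j \<noteq> 0"
  proof
    assume "v i + v k - v j = 0"
    then have "v j = v i + v k" by (simp add: algebra_simps)
    then show False using c'[of "v k"] small nz by (simp add: scaleR_2)
  qed
  moreover have "v j + v k - v i \<noteq> 0"
  proof
    assume "v j + v k - v i = 0"
    then have "v i = v j + v k" by (simp add: algebra_simps)
    then show False using b'[of "v k"] small nz by (simp add: scaleR_2)
  qed
  ultimately have ge: "D (j - 1) \<le> norm ((1/2) *\<^sub>R (v i + v j - v k))"
    "norm (v i) < norm ((1/2) *\<^sub>R (v i + v k - v j))"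
    "norm (v k) < norm ((1/2) *\<^sub>R (v j + v k - v i))"
    using a b c small by auto
  have "norm (v j) \<le> D (j - 1)" using anti[of "j - 1" j] bounds norm_v[OF J(2)] by simp
  with ge(1) have "norm (v j) \<le> norm ((1/2) *\<^sub>R (v i + v j - v k))" by simp
  then have "(norm (v j))\<^sup>2 \<le> (norm ((1/2) *\<^sub>R (v i + v j - v k)))\<^sup>2" by (simp add: power_mono)
  moreover have "(norm (v i))\<^sup>2 < (norm ((1/2) *\<^sub>R (v i + v k - v j)))\<^sup>2"
    "(norm (v k))\<^sup>2 < (norm ((1/2) *\<^sub>R (v j + v k - v i)))\<^sup>2"
    using ge(2,3) by (simp_all only: power_strict_mono norm_ge_zero pos2)
  moreover have "0 \<le> (norm ((1/2) *\<^sub>R (v i + v j + v k)))\<^sup>2" by simp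
  ultimately show False using norm_sq_half_sums[of "v i" "v j" "v k"] by linarith
qed

text \<open>If two indices agree, their sum is divisible by 2 and the third record would be too,
  against \<open>record_odd\<close>; otherwise the indices are sorted.\<close>

lemma sum_three_records_odd:
  assumes J: "i \<in> J" "j \<in> J" "k \<in> J"
    and even: "even (i + j + k)" and z: "z \<in> L" "l i + l j + l k = 2 *\<^sub>R z"
  shows False
proof -
  have eq: False if "i \<in> J" "k \<in> J" "even (i + i + k)" "l i + l i + l k = 2 *\<^sub>R z" for i k
  proof (rule record_odd[OF that(2)])
    show "even k" using that(3) by simp
    show "z - l i \<in> L" using z l that by (auto intro: diff)
    show "l k = 2 *\<^sub>R (z - l i)" using that(4) by (simp add: scaleR_diff_right scaleR_2 algebra_simps)
  qed
  consider "i = j" | "i = k" | "j = k" | "k < j" "j < i" | "j < k" "k < i" | "k < i" "i < j"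
    | "i < k" "k < j" | "i < j" "j < k" | "j < i" "i < k" by linarith
  then show False
  proof cases
    case 1 then show ?thesis using eq[of i k] assms by simp
  next
    case 2 then show ?thesis using eq[of i j] assms by (simp add: ac_simps)
  next
    case 3 then show ?thesis using eq[of j i] assms by (simp add: ac_simps)
  next
    case 4 then show ?thesis using sum_three_records_odd_less[of i j k z] assms by (simp add: ac_simps)
  next
    case 5 then show ?thesis using sum_three_records_odd_less[of i k j z] assms by (simp add: ac_simps)
  next
    case 6 then show ?thesis using sum_three_records_odd_less[of j i k z] assms by (simp add: ac_simps)
  next
    case 7 then show ?thesis using sum_three_records_odd_less[of j k i z] assms by (simp add: ac_simps)
  next
    case 8 then show ?thesis using sum_three_records_odd_less[of k j i z] assms by (simp add: ac_simps)
  next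
    case 9 then show ?thesis using sum_three_records_odd_less[of k i j z] assms by (simp add: ac_simps)
  qed
qed

lemma card_records: "card J \<le> 2 ^ dim (span L)"
proof (cases "J = {}")
  case False
  then obtain i0 where i0: "i0 \<in> J" by blast
  have "finite J" using J by (rule finite_subset) simp
  \<comment> \<open>The flag selects between w_i and w_i + w_{i0}, which doubles the family and so
    halves the bound from \<open>card_incongruent_mod_2\<close>.\<close>
  define f where "f p = (if snd p then (fst p + i0, l (fst p) + l i0) else (fst p, l (fst p)))"
    for p :: "int \<times> bool"
  \<comment> \<open>Modulo 2, a congruence of w_i with w_j + w_{i0} says that w_i + w_j + w_{i0}
    vanishes; the indices may coincide.\<close>
  have mixed: False if h: "i \<in> J" "j \<in> J" "even (i + j + i0)" "\<exists>z\<in>L. l i - (l j + l i0) = 2 *\<^sub>R z" for i j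
  proof -
    obtain z where z: "z \<in> L" "l i - (l j + l i0) = 2 *\<^sub>R z" using h(4) by blast
    have "l i = 2 *\<^sub>R z + l j + l i0" using z(2) by (simp add: algebra_simps)
    then have "l i + l j + l i0 = 2 *\<^sub>R (z + l j + l i0)" by (simp add: scaleR_2)
    moreover have "z + l j + l i0 \<in> L" using z that i0 l by (intro add) auto
    ultimately show False using sum_three_records_odd that i0 by blast
  qed
  have "card (J \<times> (UNIV :: bool set)) \<le> 2 ^ (dim (span L) + 1)"
  proof (rule card_incongruent_mod_2[of _ f])
    fix p q assume p: "p \<in> J \<times> (UNIV :: bool set)" and q: "q \<in> J \<times> (UNIV :: bool set)"
      and ne: "p \<noteq> q" and e: "even (fst (f p) - fst (f q))"
      and z: "\<exists>z\<in>L. snd (f p) - snd (f q) = 2 *\<^sub>R z"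
    obtain i s j t where pq: "p = (i, s)" "q = (j, t)" by (cases p, cases q)
    have ij: "i \<in> J" "j \<in> J" using p q pq by auto
    from z obtain y where y: "y \<in> L" "snd (f p) - snd (f q) = 2 *\<^sub>R y" by blast
    consider "s = t" | "\<not> s" t | s "\<not> t" by blast
    then show False
    proof cases
      case 1
      then have "even (i - j)" "l i - l j = 2 *\<^sub>R y" "i \<noteq> j"
        using e y ne by (auto simp: f_def pq split: if_splits)
      then show False using records_incongruent ij y by blast
    next
      case 2
      then show False using mixed[of i j] ij e z by (auto simp: f_def pq)
    next
      case 3
      then have "l j - (l i + l i0) = 2 *\<^sub>R (- y)" using y by (simp add: f_def pq algebra_simps)
      then show False using mixed[of j i] ij e neg[OF y(1)] 3 by (fastforce simp: f_def pq)
    qed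
  qed (use \<open>finite J\<close> l i0 in \<open>auto simp: f_def intro: add\<close>)
  then show ?thesis by (simp add: card_cartesian_product)
qed simp

end

lemma universal_distance_bound_pow2:
  assumes "1 \<le> d"
  shows "universal_distance_bound TYPE('a::euclidean_space) d (2 ^ d + 1)"
  unfolding universal_distance_bound_def
proof (intro allI impI)
  fix V L :: "'a set" and \<alpha> :: 'a and N :: int
  assume *: "subspace V \<and> dim V = d \<and> full_rank_lattice V L \<and> \<alpha> \<in> V \<and> N \<ge> 2"
  then have span: "span L = V" and N: "N \<ge> 2" and dim: "dim V = d" by (auto simp: full_rank_lattice_def)
  interpret discrete_subgroup L
    using * by unfold_locales (auto simp: full_rank_lattice_def)
  \<comment> \<open>A nonzero lattice vector exists because the dimension is positive; it makes
    every \<open>D K\<close> with \<open>K >= 0\<close> an attained minimum.\<close>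
  have "\<not> L \<subseteq> {0}"
  proof
    assume "L \<subseteq> {0}"
    then have "span L = {0}" using span_mono[of L "{0}"] span_zero by (auto simp: span_insert_0)
    then show False using span dim assms by auto
  qed
  then obtain l0 where l0: "l0 \<in> L" "l0 \<noteq> 0" by blast
  define D where "D = min_distance \<alpha> L"
  define M where "M = N div 2"
  define J where "J = {K\<in>{M<..N - 1}. D K < D (K - 1)}"
  have M: "0 \<le> M" "N - 1 \<le> 2 * M" using N by (auto simp: M_def)
  have le: "D K \<le> norm (of_int k *\<^sub>R \<alpha> + x)"
    if "\<bar>k\<bar> \<le> K" "x \<in> L" "of_int k *\<^sub>R \<alpha> + x \<noteq> 0" for k K x
    unfolding D_def using that by (intro min_distance(2)[OF l0]) auto
  have attained: "\<exists>k x. D K = norm (of_int k *\<^sub>R \<alpha> + x) \<and> \<bar>k\<bar> \<le> K \<and> x \<in> L \<and> of_int k *\<^sub>R \<alpha> + x \<noteq> 0"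
    if "K \<ge> 0" for K
    using min_distance(1)[OF l0 that, of \<alpha>] unfolding D_def by blast
  have anti: "D K' \<le> D K" if "0 \<le> K" "K \<le> K'" for K K'
    using attained[OF that(1)] that le by fastforce
  have "\<exists>x. x \<in> L \<and> of_int i *\<^sub>R \<alpha> + x \<noteq> 0 \<and> norm (of_int i *\<^sub>R \<alpha> + x) = D i" if i: "i \<in> J" for i
  proof -
    have i0: "0 < i" using i M by (auto simp: J_def)
    then obtain k x where k: "D i = norm (of_int k *\<^sub>R \<alpha> + x)" "\<bar>k\<bar> \<le> i" "x \<in> L"
      "of_int k *\<^sub>R \<alpha> + x \<noteq> 0" using attained[of i] by auto
    have "D i < D (i - 1)" using i by (simp add: J_def)
    then have "\<not> \<bar>k\<bar> \<le> i - 1" using le[of k "i - 1" x] k by linarith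
    then have "k = i \<or> k = - i" using k by linarith
    then show ?thesis
    proof
      assume "k = - i"
      then have "of_int i *\<^sub>R \<alpha> + (- x) = - (of_int k *\<^sub>R \<alpha> + x)" by simp
      then show ?thesis using k neg by (intro exI[of _ "- x"]) (metis neg_equal_0_iff_equal norm_minus_cancel)
    qed (use k in auto)
  qed
  then obtain l where l: "\<And>i. i \<in> J \<Longrightarrow> l i \<in> L \<and> of_int i *\<^sub>R \<alpha> + l i \<noteq> 0 \<and>
      norm (of_int i *\<^sub>R \<alpha> + l i) = D i" by metis
  interpret distance_records L \<alpha> D M J l
    using le anti M l by unfold_locales (auto simp: J_def)
  have "delta \<alpha> L N ` {1..N} \<subseteq> D ` {M..N - 1}"
    using delta_eq_min_distance[of _ N \<alpha>] by (auto simp: D_def M_def)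
  also have "\<dots> \<subseteq> insert (D M) (D ` J)"
    unfolding J_def using M by (intro image_subset_records anti) auto
  finally have sub: "delta \<alpha> L N ` {1..N} \<subseteq> insert (D M) (D ` J)" .
  have "finite J" unfolding J_def by (rule finite_subset[of _ "{M<..N - 1}"]) auto
  with sub have "num_distances \<alpha> L N \<le> card (insert (D M) (D ` J))"
    unfolding num_distances_def by (intro card_mono) auto
  also have "\<dots> \<le> Suc (card (D ` J))" by (rule card_insert_le_m1) auto
  also have "\<dots> \<le> Suc (card J)" using \<open>finite J\<close> by (simp add: card_image_le)
  also have "\<dots> \<le> 2 ^ d + 1" using card_records span dim by simp
  finally have "int (num_distances \<alpha> L N) \<le> int (2 ^ d + 1)" by (rule of_nat_mono)
  then show "int (num_distances \<alpha> L N) \<le> 2 ^ d + 1" by simp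
qed

section \<open>Lower bound: the perturbed cube\<close>

text \<open>Used to number the vertices of the cube by \<open>t < 2 ^ d\<close>, with binary digits
  as signs.\<close>

lemma sum_binary_digits: "(\<Sum>i<d. 2 ^ i * (t div 2 ^ i mod 2)) = (t :: int) mod 2 ^ d"
proof (induction d)
  case (Suc d)
  then show ?case using zmod_zmult2_eq[of 2 t "2 ^ d"] by (simp add: mult.commute)
qed simp

text \<open>
  The example attaining \<open>2 ^ d + 1\<close>: the points \<open>vec x h\<close>, where all coordinates of \<open>x\<close> have the
  parity of \<open>h\<close>, carry the additive label \<open>lab x h\<close>; \<open>L\<close> consists of the points with label 0, and
  \<open>\<alpha>\<close> has label 1. The points of the body centred cubic lattice (\<open>h = 0, 1\<close> without the shift by
  multiples of \<open>1 / 100\<close>) of minimal norm are the vertices of a cube; their labels are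
  \<open>32 + (\<Sum>i<d. 2 ^ i * x i)\<close>, and the shift makes their norms decreasing in the label.
\<close>
locale cube_example =
  fixes d :: nat and e :: "nat \<Rightarrow> 'a::euclidean_space"
  assumes d: "1 \<le> d" "d \<le> 3"
    and orthonormal: "\<And>i j. i < d \<Longrightarrow> j < d \<Longrightarrow> e i \<bullet> e j = (if i = j then 1 else 0)"
begin

definition vec :: "(nat \<Rightarrow> int) \<Rightarrow> int \<Rightarrow> 'a" where
  "vec x h = (\<Sum>i<d. (of_int (x i) - of_int h / 100 * 2 ^ i) *\<^sub>R e i)"

definition lab :: "(nat \<Rightarrow> int) \<Rightarrow> int \<Rightarrow> int" where
  "lab x h = 32 * h + (\<Sum>i<d. 2 ^ i * x i)"

definition valid :: "(nat \<Rightarrow> int) \<Rightarrow> int \<Rightarrow> bool" where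
  "valid x h \<longleftrightarrow> (\<forall>i<d. even (x i - h))"

definition L :: "'a set" where
  "L = {vec x h | x h. valid x h \<and> lab x h = 0}"

text \<open>All coordinates are odd, as \<open>h = 1\<close> demands, and the first makes the label
  32 - 29 - 2^d + (2^d - 2) = 1.\<close>

definition x\<alpha> :: "nat \<Rightarrow> int" where
  "x\<alpha> i = (if i = 0 then - 29 - 2 ^ d else 1)"

definition \<alpha> :: 'a where "\<alpha> = vec x\<alpha> 1"

text \<open>The squared norm of the shifted vertex with label \<open>k\<close>: in the sum of (x_i -
  2^i/100)^2 with x_i = 1 or -1, the mixed terms add up to -(k - 32)/50.\<close>

definition sq_norm :: "int \<Rightarrow> real" where
  "sq_norm k = real d + (\<Sum>i<d. 4 ^ i) / 10000 - of_int (k - 32) / 50"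

lemma d_cases: "d = 1 \<or> d = 2 \<or> d = 3" using d by linarith

lemma norm_sum_sq: "(norm (\<Sum>i<d. c i *\<^sub>R e i))\<^sup>2 = (\<Sum>i<d. (c i)\<^sup>2)"
proof -
  have "(norm (\<Sum>i<d. c i *\<^sub>R e i))\<^sup>2 = (\<Sum>i<d. \<Sum>j<d. c i * (c j * (e i \<bullet> e j)))"
    by (simp add: power2_norm_eq_inner inner_sum_left inner_sum_right sum_distrib_left inner_commute
        mult.left_commute)
  also have "\<dots> = (\<Sum>i<d. \<Sum>j<d. if i = j then (c i)\<^sup>2 else 0)"
    by (intro sum.cong refl) (simp add: orthonormal power2_eq_square)
  finally show ?thesis by simp
qed

lemma norm_vec: "(norm (vec x h))\<^sup>2 = (\<Sum>i<d. (of_int (x i) - of_int h / 100 * 2 ^ i)\<^sup>2)"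
  unfolding vec_def by (rule norm_sum_sq)

lemma vec_add: "vec (\<lambda>i. x i + y i) (h + k) = vec x h + vec y k"
  unfolding vec_def sum.distrib[symmetric] scaleR_add_left[symmetric]
  by (intro sum.cong refl arg_cong2[where f = scaleR]) (simp add: algebra_simps add_divide_distrib)

lemma vec_scale: "vec (\<lambda>i. k * x i) (k * h) = of_int k *\<^sub>R vec x h"
  by (simp add: vec_def scaleR_sum_right right_diff_distrib mult.assoc)

lemma vec_minus: "vec (\<lambda>i. - x i) (- h) = - vec x h"
  using vec_scale[of "-1" x h] by simp

lemma lab_add: "lab (\<lambda>i. x i + y i) (h + k) = lab x h + lab y k"
  by (simp add: lab_def sum.distrib algebra_simps)

lemma lab_scale: "lab (\<lambda>i. k * x i) (k * h) = k * lab x h"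
  by (simp add: lab_def sum_distrib_left algebra_simps)

lemma lab_minus: "lab (\<lambda>i. - x i) (- h) = - lab x h"
  using lab_scale[of "-1" x h] by simp

lemma valid_add: "valid x h \<Longrightarrow> valid y k \<Longrightarrow> valid (\<lambda>i. x i + y i) (h + k)"
  and valid_scale: "valid x h \<Longrightarrow> valid (\<lambda>i. k * x i) (k * h)"
  and valid_minus: "valid x h \<Longrightarrow> valid (\<lambda>i. - x i) (- h)"
  by (auto simp: valid_def)

lemma x\<alpha>: "valid x\<alpha> 1" "lab x\<alpha> 1 = 1"
  using d_cases by (auto simp: valid_def lab_def x\<alpha>_def numeral_eq_Suc)

lemma L_0: "0 \<in> L"
  unfolding L_def
  by (intro CollectI exI[of _ "\<lambda>_. 0"] exI[of _ 0]) (simp add: vec_def lab_def valid_def)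

lemma L_add: "u \<in> L \<Longrightarrow> v \<in> L \<Longrightarrow> u + v \<in> L"
  unfolding L_def using vec_add valid_add lab_add by (smt (verit) mem_Collect_eq)

lemma L_minus: "u \<in> L \<Longrightarrow> - u \<in> L"
  unfolding L_def using vec_minus valid_minus lab_minus by (smt (verit) mem_Collect_eq)

text \<open>With its converse \<open>vec_eq_multiple_add_L\<close>, this identifies the vectors
  \<open>k \<alpha> + l\<close> with the points of valid pairs, the label being the multiplier:
  labels are additive and \<alpha> has label 1.\<close>

lemma multiple_add_L:
  assumes "l \<in> L"
  obtains x h where "of_int k *\<^sub>R \<alpha> + l = vec x h" "valid x h" "lab x h = k"
proof -
  obtain y h where y: "l = vec y h" "valid y h" "lab y h = 0" using assms by (auto simp: L_def)
  show ?thesis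
  proof (rule that)
    show "of_int k *\<^sub>R \<alpha> + l = vec (\<lambda>i. k * x\<alpha> i + y i) (k * 1 + h)"
      by (simp only: y(1) \<alpha>_def vec_add vec_scale)
    show "valid (\<lambda>i. k * x\<alpha> i + y i) (k * 1 + h)"
      by (intro valid_add valid_scale y(2) x\<alpha>)
    show "lab (\<lambda>i. k * x\<alpha> i + y i) (k * 1 + h) = k"
      by (simp only: lab_add lab_scale y(3) x\<alpha>)
  qed
qed

lemma vec_eq_multiple_add_L:
  assumes "valid x h" "lab x h = k"
  obtains l where "l \<in> L" "vec x h = of_int k *\<^sub>R \<alpha> + l"
proof (rule that)
  have "valid (\<lambda>i. x i + - k * x\<alpha> i) (h + - k * 1)"
    by (intro valid_add valid_scale assms(1) x\<alpha>)
  moreover have "lab (\<lambda>i. x i + - k * x\<alpha> i) (h + - k * 1) = 0"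
    by (simp only: lab_add lab_scale assms(2) x\<alpha>)
  ultimately have "vec (\<lambda>i. x i + - k * x\<alpha> i) (h + - k * 1) \<in> L"
    unfolding L_def by blast
  then show "vec x h + of_int (- k) *\<^sub>R \<alpha> \<in> L"
    by (simp only: vec_add vec_scale \<alpha>_def)
qed simp

text \<open>Label 0 means that the sum of 2^i x_i is -32 h, so the mixed terms of the squared norm
  add up to 32/50 h^2 >= 0. What remains is at least the sum of x_i^2, a positive integer.\<close>

lemma norm_ge_1:
  assumes "l \<in> L" "l \<noteq> 0"
  shows "1 \<le> norm l"
proof -
  obtain x h where x: "l = vec x h" "lab x h = 0" using assms by (auto simp: L_def)
  have "\<exists>i<d. x i \<noteq> 0"
  proof (rule ccontr)
    assume *: "\<not> (\<exists>i<d. x i \<noteq> 0)"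
    then have "h = 0" using x(2) by (simp add: lab_def)
    then show False using * assms(2) by (simp add: x(1) vec_def)
  qed
  then obtain i where i: "i < d" "x i \<noteq> 0" by blast
  have "1 \<le> \<bar>x i\<bar>" using i by linarith
  then have "1 \<le> (x i)\<^sup>2" using power_mono[of 1 "\<bar>x i\<bar>" 2] by simp
  also have "\<dots> \<le> (\<Sum>i<d. (x i)\<^sup>2)" using i by (intro member_le_sum) auto
  finally have "1 \<le> real_of_int (\<Sum>i<d. (x i)\<^sup>2)" by linarith
  moreover have "(\<Sum>i<d. 2 ^ i * x i) = - (32 * h)"
    using x(2) by (simp add: lab_def)
  then have "real_of_int (\<Sum>i<d. 2 ^ i * x i) = of_int (- (32 * h))" by (simp only:)
  then have "(\<Sum>i<d. 2 ^ i * real_of_int (x i)) = - (32 * of_int h)" by simp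
  then have "(\<Sum>i<d. - (of_int h / 50) * (2 ^ i * real_of_int (x i))) = 32 / 50 * (of_int h)\<^sup>2"
    unfolding sum_distrib_left[symmetric] by (simp add: power2_eq_square)
  moreover have "(norm l)\<^sup>2 = real_of_int (\<Sum>i<d. (x i)\<^sup>2)
      + (\<Sum>i<d. - (of_int h / 50) * (2 ^ i * real_of_int (x i))) + (\<Sum>i<d. (of_int h / 100 * 2 ^ i)\<^sup>2)"
    unfolding x(1) norm_vec of_int_sum sum.distrib[symmetric]
    by (intro sum.cong refl) (simp add: power2_diff)
  moreover have "0 \<le> (\<Sum>i<d. (real_of_int h / 100 * 2 ^ i)\<^sup>2)" by (intro sum_nonneg) simp
  moreover have "0 \<le> (real_of_int h)\<^sup>2" by simp
  ultimately have "1\<^sup>2 \<le> (norm l)\<^sup>2" unfolding one_power2 by linarith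
  then show ?thesis by (rule power2_le_imp_le) simp
qed

lemma vec_in_span: "vec x h \<in> span (e ` {..<d})"
  unfolding vec_def by (intro span_sum span_mul span_base) auto

lemma span_L: "span L = span (e ` {..<d})"
proof (rule antisym)
  show "span L \<subseteq> span (e ` {..<d})"
    by (rule span_minimal) (auto simp: L_def vec_in_span)
  \<comment> \<open>\<open>A\<close> is the direction of the shift.\<close>
  define A where "A = (\<Sum>i<d. 2 ^ i *\<^sub>R e i)"
  have u: "64 *\<^sub>R e i + (2 * 2 ^ i / 100) *\<^sub>R A \<in> span L" if i: "i < d" for i
  proof -
    \<comment> \<open>Both entries are even, and the label is 64 * 2^i - 32 * 2 * 2^i = 0.\<close>
    let ?x = "\<lambda>j. if j = i then 64 else 0" and ?h = "- 2 * 2 ^ i :: int"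
    have "valid ?x ?h" by (simp add: valid_def)
    moreover have "lab ?x ?h = 0" using i by (simp add: lab_def if_distrib cong: if_cong)
    moreover have "vec ?x ?h = (\<Sum>j<d. (if j = i then 64 *\<^sub>R e i else 0))
        + (\<Sum>j<d. (2 * 2 ^ i / 100) *\<^sub>R (2 ^ j *\<^sub>R e j))"
      unfolding vec_def sum.distrib[symmetric] by (intro sum.cong refl) (auto simp: scaleR_add_left)
    ultimately have "64 *\<^sub>R e i + (2 * 2 ^ i / 100) *\<^sub>R A \<in> L"
      unfolding L_def A_def scaleR_sum_right using i by (intro CollectI exI[of _ ?x] exI[of _ ?h]) simp
    then show ?thesis by (rule span_base)
  qed
  define S :: real where "S = 64 + (\<Sum>i<d. 2 * 2 ^ i / 100 * 2 ^ i)"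
  have "S > 0" unfolding S_def by (intro add_pos_nonneg sum_nonneg) auto
  \<comment> \<open>Weighting by 2^i turns the first summands into \<open>64 A\<close>, so a
    positive multiple of \<open>A\<close>, and then each \<open>e i\<close>, lies in the
    span.\<close>
  have "(\<Sum>i<d. 2 ^ i *\<^sub>R (64 *\<^sub>R e i + (2 * 2 ^ i / 100) *\<^sub>R A))
      = 64 *\<^sub>R (\<Sum>i<d. 2 ^ i *\<^sub>R e i) + (\<Sum>i<d. 2 * 2 ^ i / 100 * 2 ^ i) *\<^sub>R A"
    by (simp add: scaleR_add_right sum.distrib scaleR_sum_right scaleR_sum_left mult_ac)
  also have "\<dots> = S *\<^sub>R A"
    by (simp only: S_def A_def[symmetric] scaleR_add_left)
  finally have "(\<Sum>i<d. 2 ^ i *\<^sub>R (64 *\<^sub>R e i + (2 * 2 ^ i / 100) *\<^sub>R A)) = S *\<^sub>R A" .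
  moreover have "(\<Sum>i<d. 2 ^ i *\<^sub>R (64 *\<^sub>R e i + (2 * 2 ^ i / 100) *\<^sub>R A)) \<in> span L"
    by (intro span_sum span_mul u) auto
  ultimately have "(1 / S) *\<^sub>R (S *\<^sub>R A) \<in> span L" by (metis span_mul)
  then have A: "A \<in> span L" using \<open>S > 0\<close> by simp
  have "e i \<in> span L" if "i < d" for i
  proof -
    have "(1 / 64) *\<^sub>R ((64 *\<^sub>R e i + (2 * 2 ^ i / 100) *\<^sub>R A) - (2 * 2 ^ i / 100) *\<^sub>R A) \<in> span L"
      using u[OF that] A by (intro span_mul span_diff)
    then show ?thesis by simp
  qed
  then show "span (e ` {..<d}) \<subseteq> span L" by (intro span_minimal) auto
qed

lemma full_rank: "full_rank_lattice (span (e ` {..<d})) L"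
proof -
  have "uniform_discrete L" unfolding uniform_discrete_def
  proof (intro exI[of _ 1] conjI ballI impI)
    fix u v assume "u \<in> L" "v \<in> L" "dist u v < 1"
    then show "u = v" using norm_ge_1[of "u - v"] L_add[of u "- v"] L_minus[of v]
      by (auto simp: dist_norm)
  qed simp
  then show ?thesis
    by (simp add: full_rank_lattice_def L_0 L_add L_minus span_L uniform_discrete_imp_discrete)
qed

lemma dim_span_e: "dim (span (e ` {..<d})) = d"
proof -
  have inj: "inj_on e {..<d}"
    using orthonormal by (metis (mono_tags) inj_onI lessThan_iff zero_neq_one)
  have "pairwise orthogonal (e ` {..<d})"
    using orthonormal by (auto simp: pairwise_def orthogonal_def)
  moreover have "0 \<notin> e ` {..<d}"
    using orthonormal by (metis (mono_tags) imageE inner_zero_left lessThan_iff zero_neq_one)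
  ultimately have "independent (e ` {..<d})" by (rule pairwise_orthogonal_independent)
  then show ?thesis by (simp add: dim_eq_card_independent card_image[OF inj])
qed

text \<open>The vertices must be shorter than the nonzero points with even coordinates and
  \<open>h = 0\<close>, whose squared norm is at least 4; this needs \<open>d <= 3\<close>. The
  smallest vertex label is 25 = 33 - 2^3.\<close>

lemma sq_norm_less_4: "25 \<le> k \<Longrightarrow> sq_norm k < 4"
  using d_cases by (auto simp: sq_norm_def numeral_eq_Suc field_simps)

text \<open>A short vector with a label in the relevant range is a vertex of the cube.\<close>
lemma norm_short_vec:
  assumes "valid x h" "0 \<le> lab x h" "lab x h \<le> 40" "vec x h \<noteq> 0" "(norm (vec x h))\<^sup>2 < 4"
  shows "(norm (vec x h))\<^sup>2 = sq_norm (lab x h)"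
proof -
  define c where "c i = real_of_int (x i) - of_int h / 100 * 2 ^ i" for i
  have c: "\<bar>c i\<bar> < 2" if "i < d" for i
  proof -
    have "(c i)\<^sup>2 \<le> (\<Sum>i<d. (c i)\<^sup>2)" using that by (intro member_le_sum) auto
    also have "\<dots> < 2\<^sup>2" using assms(5) by (simp add: norm_vec c_def)
    finally show ?thesis using abs_le_square_iff[of 2 "c i"] by simp
  qed
  define q :: real where "q = 32 + (\<Sum>i<d. 4 ^ i) / 100"
  have "2 ^ i * c i = 2 ^ i * of_int (x i) - of_int h / 100 * 4 ^ i" for i
    using power_mult_distrib[of "2 :: real" 2 i] by (simp add: c_def right_diff_distrib)
  then have "(\<Sum>i<d. 2 ^ i * c i) = (\<Sum>i<d. 2 ^ i * of_int (x i)) - of_int h / 100 * (\<Sum>i<d. 4 ^ i)"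
    by (simp add: sum_subtractf sum_distrib_left)
  then have lab: "real_of_int (lab x h) = (\<Sum>i<d. 2 ^ i * c i) + of_int h * q"
    by (simp add: lab_def q_def distrib_left)
  have "\<bar>\<Sum>i<d. 2 ^ i * c i\<bar> \<le> (\<Sum>i<d. 2 ^ i * 2)"
    by (rule order_trans[OF sum_abs]) (auto intro!: sum_mono simp: abs_mult less_imp_le[OF c])
  also have "\<dots> \<le> 14" using d_cases by (auto simp: numeral_eq_Suc)
  finally have sum_c: "\<bar>\<Sum>i<d. 2 ^ i * c i\<bar> \<le> 14" .
  have q: "q \<ge> 32" unfolding q_def by (simp add: sum_nonneg)
  have lab_real: "0 \<le> real_of_int (lab x h)" "real_of_int (lab x h) \<le> 40"
    using assms(2,3) by linarith+
  \<comment> \<open>The label is \<open>h * q\<close> plus an error of at most 14 = 2(1 + 2 + 4),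
    and \<open>q >= 32\<close>: it is negative for \<open>h <= -1\<close> and at least 50 for
    \<open>h >= 2\<close>.\<close>
  have "h \<ge> 0"
  proof (rule ccontr)
    assume "\<not> h \<ge> 0"
    then have "of_int h \<le> (- 1 :: real)" by linarith
    then have "of_int h * q \<le> - 1 * q" using q by (intro mult_right_mono) auto
    then show False using lab lab_real(1) sum_c q by linarith
  qed
  moreover have "h \<le> 1"
  proof (rule ccontr)
    assume "\<not> h \<le> 1"
    then have "(2 :: real) \<le> of_int h" by linarith
    then have "2 * q \<le> of_int h * q" using q by (intro mult_right_mono) auto
    then show False using lab lab_real(2) sum_c q by linarith
  qed
  ultimately consider "h = 0" | "h = 1" by linarith
  then show ?thesis
  proof cases
    case 1
    have "x i = 0" if "i < d" for i
    proof -
      have "\<bar>x i\<bar> < 2" using c[OF that] by (simp add: c_def 1)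
      moreover have "even (x i)" using assms(1) that by (simp add: valid_def 1)
      ultimately show ?thesis by presburger
    qed
    then show ?thesis using assms(4) by (simp add: vec_def 1)
  next
    case 2
    have x: "(x i)\<^sup>2 = 1" if i: "i < d" for i
    proof -
      have "2 ^ i \<le> (4 :: real)" using power_increasing[of i 2 "2 :: real"] i d by simp
      moreover have "0 < (2 :: real) ^ i" by simp
      moreover have "\<bar>real_of_int (x i) - 2 ^ i / 100\<bar> < 2" using c[OF i] by (simp add: c_def 2)
      ultimately have "\<bar>real_of_int (x i)\<bar> < 3" by linarith
      then have "\<bar>x i\<bar> < 3" by linarith
      moreover have "odd (x i)" using assms(1) i by (simp add: valid_def 2)
      ultimately have "x i = 1 \<or> x i = - 1" by presburger
      then show ?thesis by auto
    qed
    have "(norm (vec x h))\<^sup>2 = (\<Sum>i<d. 1 + 4 ^ i / 10000 - 1 / 50 * (2 ^ i * real_of_int (x i)))"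
      unfolding norm_vec
    proof (intro sum.cong refl)
      fix i assume "i \<in> {..<d}"
      then have "real_of_int ((x i)\<^sup>2) = 1" using x by simp
      moreover have "(2 ^ i)\<^sup>2 = (4 :: real) ^ i" by (simp add: power2_eq_square power_mult_distrib[symmetric])
      ultimately show "(real_of_int (x i) - real_of_int h / 100 * 2 ^ i)\<^sup>2
          = 1 + 4 ^ i / 10000 - 1 / 50 * (2 ^ i * real_of_int (x i))"
        by (simp add: 2 power2_diff power_divide)
    qed
    also have "\<dots> = sq_norm (lab x h)"
      by (simp add: sq_norm_def lab_def 2 sum.distrib sum_subtractf sum_divide_distrib)
    finally show ?thesis .
  qed
qed

lemma ex_cube_vertex:
  assumes "0 \<le> t" "t < 2 ^ d"
  obtains x where "valid x 1" "lab x 1 = 33 - 2 ^ d + 2 * t"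
    "(norm (vec x 1))\<^sup>2 = sq_norm (33 - 2 ^ d + 2 * t)" "vec x 1 \<noteq> 0"
proof -
  \<comment> \<open>Digits 0 and 1 become signs -1 and 1, so the sum of 2^i x_i is 2t - (2^d -
    1).\<close>
  define x where "x i = 2 * (t div 2 ^ i mod 2) - 1" for i
  have sgn: "x i = 1 \<or> x i = - 1" for i
  proof -
    have "u mod 2 = 0 \<or> u mod 2 = 1" for u :: int by presburger
    from this[of "t div 2 ^ i"] show ?thesis by (auto simp: x_def)
  qed
  have valid: "valid x 1" by (simp add: valid_def x_def)
  have "(\<Sum>i<d. 2 ^ i * x i) = 2 * (\<Sum>i<d. 2 ^ i * (t div 2 ^ i mod 2)) - (\<Sum>i<d. 2 ^ i)"
    by (simp add: x_def right_diff_distrib sum_subtractf sum_distrib_left mult.left_commute)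
  also have "(\<Sum>i<d. 2 ^ i) = (2 ^ d - 1 :: int)" using d_cases by (auto simp: numeral_eq_Suc)
  also have "(\<Sum>i<d. 2 ^ i * (t div 2 ^ i mod 2)) = t" using assms by (simp add: sum_binary_digits)
  finally have lab: "lab x 1 = 33 - 2 ^ d + 2 * t" by (simp add: lab_def)
  have pow: "(2 :: int) ^ d \<le> 8" using power_increasing[of d 3 "2::int"] d by simp
  \<comment> \<open>The shift is at most 4/100 and 1.04^2 < 1.1; three such terms stay below the 4
    required by \<open>norm_short_vec\<close>.\<close>
  have c: "(of_int (x i) - of_int 1 / 100 * 2 ^ i)\<^sup>2 \<in> {0<..<(1.1 :: real)}" if "i < d" for i
  proof -
    have "i = 0 \<or> i = 1 \<or> i = 2" using that d by linarith
    then show ?thesis using sgn[of i] by (auto simp: power2_eq_square)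
  qed
  have pos: "0 < (norm (vec x 1))\<^sup>2"
    unfolding norm_vec
  proof (rule sum_pos)
    show "{..<d} \<noteq> {}" using d by (metis lessThan_iff emptyE less_le_trans zero_less_one)
  qed (use c in auto)
  then have nz: "vec x 1 \<noteq> 0" by auto
  have "(norm (vec x 1))\<^sup>2 \<le> real (card {..<d}) * 1.1"
    unfolding norm_vec by (intro sum_bounded_above) (use c in force)
  also have "\<dots> < 4" using d by simp
  finally have "(norm (vec x 1))\<^sup>2 = sq_norm (lab x 1)"
    using assms pow lab nz by (intro norm_short_vec valid) auto
  then show ?thesis using that[of x] valid lab nz by simp
qed

text \<open>Passing from multipliers up to \<open>n - 1\<close> to those up to \<open>n + 1\<close>
  admits the vertex with label \<open>n\<close>. It beats all earlier vectors: those are vertices of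
  smaller label, hence longer, or have squared norm at least 4.\<close>

lemma delta_strictly_decreasing:
  assumes "0 \<le> t" "t < 2 ^ d"
  shows "delta \<alpha> L (33 + 2 ^ d) (33 - 2 ^ d + 2 * (t + 1)) < delta \<alpha> L (33 + 2 ^ d) (33 - 2 ^ d + 2 * t)"
proof -
  interpret discrete_subgroup L
    using full_rank by unfold_locales (auto simp: full_rank_lattice_def)
  have pow: "2 \<le> (2 :: int) ^ d" "(2 :: int) ^ d \<le> 8"
    using power_increasing[of d 3 "2::int"] power_increasing[of 1 d "2::int"] d by auto
  have "\<not> L \<subseteq> {0}"
  proof
    assume "L \<subseteq> {0}"
    then have "span L = {0}" using span_mono[of L "{0}"] span_zero by (auto simp: span_insert_0)
    then show False using dim_span_e d by (simp add: span_L)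
  qed
  then obtain l0 where l0: "l0 \<in> L" "l0 \<noteq> 0" by blast
  define n where "n = 33 - 2 ^ d + 2 * t"
  have n: "25 \<le> n" "n + 2 \<le> 33 + 2 ^ d" "33 + 2 ^ d - n \<le> n - 1" "n \<le> 40"
    using assms pow by (auto simp: n_def)
  have delta: "delta \<alpha> L (33 + 2 ^ d) m = min_distance \<alpha> L (m - 1)" if "m \<in> {n, n + 2}" for m
  proof -
    have "max (m - 1) (33 + 2 ^ d - m) = m - 1" using that n by auto
    then show ?thesis using delta_eq_min_distance[of m "33 + 2 ^ d" \<alpha>] that n by auto
  qed
  obtain x where x: "valid x 1" "lab x 1 = n" "(norm (vec x 1))\<^sup>2 = sq_norm n" "vec x 1 \<noteq> 0"
    using ex_cube_vertex[OF assms] n_def by blast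
  obtain l where l: "l \<in> L" "vec x 1 = of_int n *\<^sub>R \<alpha> + l"
    using vec_eq_multiple_add_L[OF x(1,2)] .
  have "min_distance \<alpha> L (n + 1) \<le> norm (vec x 1)"
    unfolding l(2) by (rule min_distance(2)[OF l0]) (use n l x in auto)
  also have "\<dots> < min_distance \<alpha> L (n - 1)"
  proof -
    obtain k l where kl: "min_distance \<alpha> L (n - 1) = norm (of_int k *\<^sub>R \<alpha> + l)" "\<bar>k\<bar> \<le> n - 1" "l \<in> L"
      "of_int k *\<^sub>R \<alpha> + l \<noteq> 0"
      using min_distance(1)[OF l0, of "n - 1" \<alpha>] n by auto
    \<comment> \<open>Negation makes the label nonnegative, as \<open>norm_short_vec\<close>
      requires.\<close>
    obtain y h where y: "norm (of_int k *\<^sub>R \<alpha> + l) = norm (vec y h)" "valid y h" "lab y h = \<bar>k\<bar>" "vec y h \<noteq> 0"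
    proof -
      obtain y h where y: "of_int k *\<^sub>R \<alpha> + l = vec y h" "valid y h" "lab y h = k"
        using multiple_add_L[OF kl(3)] .
      show ?thesis
      proof (cases "k \<ge> 0")
        case True
        then show ?thesis using that[of y h] y kl(4) by simp
      next
        case False
        then show ?thesis using that[of "\<lambda>i. - y i" "- h"] y kl(4)
          by (simp add: vec_minus lab_minus valid_minus)
      qed
    qed
    have "(norm (vec x 1))\<^sup>2 < (norm (vec y h))\<^sup>2"
    proof (cases "(norm (vec y h))\<^sup>2 < 4")
      case True
      then have "(norm (vec y h))\<^sup>2 = sq_norm \<bar>k\<bar>"
        using norm_short_vec[OF y(2)] y kl n by simp
      then show ?thesis using x(3) kl(2) by (simp add: sq_norm_def)
    next
      case False
      then show ?thesis using sq_norm_less_4[OF n(1)] x(3) by simp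
    qed
    then show ?thesis unfolding kl(1) y(1) by (rule power_less_imp_less_base) simp
  qed
  finally show ?thesis using delta[of n] delta[of "n + 2"] by (simp add: n_def algebra_simps)
qed

text \<open>The \<open>2 ^ d\<close> successive drops separate \<open>2 ^ d + 1\<close> values; the
  last index, at \<open>t = 2 ^ d\<close>, is exactly N = 33 + 2^d.\<close>

lemma num_distances_ge: "2 ^ d + 1 \<le> num_distances \<alpha> L (33 + 2 ^ d)"
proof -
  define f where "f t = delta \<alpha> L (33 + 2 ^ d) (33 - 2 ^ d + 2 * int t)" for t
  have step: "f (Suc t) < f t" if "t < 2 ^ d" for t
  proof -
    have "int t < 2 ^ d" using that by (metis of_nat_less_iff of_nat_numeral of_nat_power)
    then show ?thesis using delta_strictly_decreasing[of "int t"] by (simp add: f_def add.commute)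
  qed
  have less: "t \<le> 2 ^ d \<longrightarrow> f t < f s" if "s < t" for s t :: nat
    using that
  proof (induction rule: less_Suc_induct)
    case (1 i)
    then show ?case using step[of i] by simp
  next
    case (2 i j k)
    then show ?case by auto
  qed
  have "inj_on f {..2 ^ d}"
  proof (rule linorder_inj_onI')
    fix s t :: nat assume "s \<in> {..2 ^ d}" "t \<in> {..2 ^ d}" "s < t"
    then show "f s \<noteq> f t" using less[of s t] by auto
  qed
  then have "card (f ` {..2 ^ d}) = 2 ^ d + 1" by (simp add: card_image)
  moreover have "f ` {..2 ^ d} \<subseteq> delta \<alpha> L (33 + 2 ^ d) ` {1..33 + 2 ^ d}"
  proof (rule image_subsetI)
    fix t :: nat assume "t \<in> {..2 ^ d}"
    then have "int t \<le> 2 ^ d" by (metis atMost_iff of_nat_le_iff of_nat_numeral of_nat_power)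
    moreover have "(2 :: int) ^ d \<le> 8" using power_increasing[of d 3 "2::int"] d by simp
    ultimately show "f t \<in> delta \<alpha> L (33 + 2 ^ d) ` {1..33 + 2 ^ d}"
      unfolding f_def by (intro imageI) auto
  qed
  ultimately show ?thesis
    unfolding num_distances_def by (metis card_mono finite_atLeastAtMost_int finite_imageI)
qed

lemma universal_distance_bound_ge:
  assumes "universal_distance_bound TYPE('a) d B"
  shows "2 ^ d + 1 \<le> B"
proof -
  have "(2 :: int) \<le> 33 + 2 ^ d" using zero_le_power[of "2 :: int" d] by linarith
  then have "int (num_distances \<alpha> L (33 + 2 ^ d)) \<le> B"
    using assms[unfolded universal_distance_bound_def, rule_format,
        of "span (e ` {..<d})" L \<alpha> "33 + 2 ^ d"] full_rank dim_span_e
    by (simp add: \<alpha>_def vec_in_span del: dim_span)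
  moreover have "int (2 ^ d + 1) \<le> int (num_distances \<alpha> L (33 + 2 ^ d))"
    using num_distances_ge by (rule of_nat_mono)
  ultimately show ?thesis by simp
qed

end


section \<open>Optimality in dimensions one to three\<close>

lemma optimal_distance_bound_pow2:
  assumes "1 \<le> d" "d \<le> 3" "d \<le> DIM('a::euclidean_space)"
  shows "optimal_distance_bound TYPE('a) d (2 ^ d + 1)"
proof -
  obtain B :: "'a set" where B: "B \<subseteq> Basis" "card B = d" "finite B"
    using obtain_subset_with_card_n[OF assms(3)] by metis
  obtain e where e: "bij_betw e {0..<d} B"
    using ex_bij_betw_nat_finite[OF B(3)] B(2) by blast
  have eB: "e i \<in> Basis" if "i < d" for i
    using bij_betwE[OF e] B(1) that by auto
  interpret cube_example d e
  proof
    fix i j assume "i < d" "j < d"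
    moreover from this have "e i = e j \<longleftrightarrow> i = j"
      using bij_betw_imp_inj_on[OF e] by (auto simp: inj_on_def)
    ultimately show "e i \<bullet> e j = (if i = j then 1 else 0)"
      using eB by (simp add: inner_Basis)
  qed (use assms in auto)
  show ?thesis
    unfolding optimal_distance_bound_def
    using universal_distance_bound_pow2[OF assms(1)] universal_distance_bound_ge by blast
qed

theorem corollary5p2:
  shows "(1 \<le> DIM('a::euclidean_space) \<longrightarrow> optimal_distance_bound TYPE('a) 1 3) \<and>
         (2 \<le> DIM('a) \<longrightarrow> optimal_distance_bound TYPE('a) 2 5) \<and>
         (3 \<le> DIM('a) \<longrightarrow> optimal_distance_bound TYPE('a) 3 9)"
  using optimal_distance_bound_pow2[of 1, where 'a = 'a]
    optimal_distance_bound_pow2[of 2, where 'a = 'a]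
    optimal_distance_bound_pow2[of 3, where 'a = 'a]
  by simp

end
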